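(* If a graph $G$ is strongly EFX-orientable, then $\chi(G)\le 3$.
   Context: All graphs are finite and simple. For a graph $G=(V,E)$ and $v\in V$, $E(v)$ is the set of edges incident to $v$. A graphical instance on $G$ assigns to each vertex $v$ a valuation $f_v:2^E\to\mathbb{R}_{\ge 0}$ that is monotone ($A\subseteq B\Rightarrow f_v(A)\le f_v(B)$) and satisfies $f_v(X)=f_v(X\cap E(v))$ for all $X\subseteq E$. An orientation of $G$ chooses for each edge one of its endpoints as its head; vertex $v$ receives the bundle $X_v$ of edges whose head is $v$. The orientation is EFX if for all $u,v\in V$ and every $g\in X_v$, $f_u(X_u)\ge f_u(X_v\setminus\{g\})$. A graph $G$ is strongly EFX-orientable if for every graphical instance on $G$ there exists an EFX orientation. *)

theory Defs
  imports Complex_Main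
begin

definition simple_graph :: "'v set \<Rightarrow> 'v set set \<Rightarrow> bool" where
  "simple_graph V E \<longleftrightarrow> finite V \<and> (\<forall>e\<in>E. e \<subseteq> V \<and> card e = 2)"

definition incident :: "'v set set \<Rightarrow> 'v \<Rightarrow> 'v set set" where
  "incident E v = {e \<in> E. v \<in> e}"

definition graphical_instance ::
  "'v set \<Rightarrow> 'v set set \<Rightarrow> ('v \<Rightarrow> 'v set set \<Rightarrow> real) \<Rightarrow> bool" where
  "graphical_instance V E f \<longleftrightarrow>
     (\<forall>v\<in>V. (\<forall>X. X \<subseteq> E \<longrightarrow> f v X \<ge> 0)
          \<and> (\<forall>A B. A \<subseteq> B \<and> B \<subseteq> E \<longrightarrow> f v A \<le> f v B)
          \<and> (\<forall>X. X \<subseteq> E \<longrightarrow> f v X = f v (X \<inter> incident E v)))"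

definition orientation :: "'v set set \<Rightarrow> ('v set \<Rightarrow> 'v) \<Rightarrow> bool" where
  "orientation E h \<longleftrightarrow> (\<forall>e\<in>E. h e \<in> e)"

definition bndl :: "'v set set \<Rightarrow> ('v set \<Rightarrow> 'v) \<Rightarrow> 'v \<Rightarrow> 'v set set" where
  "bndl E h v = {e \<in> E. h e = v}"

definition EFX_orientation ::
  "'v set \<Rightarrow> 'v set set \<Rightarrow> ('v \<Rightarrow> 'v set set \<Rightarrow> real) \<Rightarrow> ('v set \<Rightarrow> 'v) \<Rightarrow> bool" where
  "EFX_orientation V E f h \<longleftrightarrow> orientation E h \<and>
     (\<forall>u\<in>V. \<forall>v\<in>V. \<forall>g\<in>bndl E h v. f u (bndl E h u) \<ge> f u (bndl E h v - {g}))"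

definition strongly_EFX_orientable :: "'v set \<Rightarrow> 'v set set \<Rightarrow> bool" where
  "strongly_EFX_orientable V E \<longleftrightarrow>
     (\<forall>f. graphical_instance V E f \<longrightarrow> (\<exists>h. EFX_orientation V E f h))"

definition colorable :: "'v set \<Rightarrow> 'v set set \<Rightarrow> nat \<Rightarrow> bool" where
  "colorable V E k \<longleftrightarrow> (\<exists>c::'v \<Rightarrow> nat. (\<forall>v\<in>V. c v < k) \<and>
      (\<forall>e\<in>E. \<forall>u\<in>e. \<forall>w\<in>e. u \<noteq> w \<longrightarrow> c u \<noteq> c w))"

definition chromatic_number :: "'v set \<Rightarrow> 'v set set \<Rightarrow> nat" where
  "chromatic_number V E = (LEAST k. colorable V E k)"

end

theory Submission
  imports Defs
begin

text \<open>
  Suppose that \<open>G\<close> is not 3-colourable, let \<open>E'\<close> be a maximal 3-colourable set of edges, and let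
  \<open>{x, y}\<close> be a further edge. In a 3-colouring of \<open>E'\<close> the vertices \<open>x\<close> and \<open>y\<close> have the same colour,
  and Kempe chains in both other colours connect them. Going from \<open>x\<close> to \<open>y\<close> along one chain and back
  along the other gives a closed walk \<open>A\<^sub>0, B\<^sub>0, A\<^sub>1, B\<^sub>1, \<dots>, A\<^sub>N = A\<^sub>0 = x\<close> whose vertices \<open>B\<^sub>i\<close> are
  distinct. Let every vertex value a bundle by its heaviest incident edge, where the edges \<open>A\<^sub>iB\<^sub>i\<close>
  have weight 2, \<open>xy\<close> has weight 1 and all other edges have weight 0. In an EFX orientation, if one
  edge \<open>B\<^sub>iA\<^sub>i\<^sub>+\<^sub>1\<close> points to \<open>A\<^sub>i\<^sub>+\<^sub>1\<close>, then the next one points to \<open>A\<^sub>i\<^sub>+\<^sub>2\<close>, hence all of them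
  behave in the same way, and in either case the edge \<open>xy\<close> cannot be oriented.
\<close>

section \<open>Maximum-weight instances\<close>

text \<open>Let each vertex value a bundle by its heaviest incident edge. If \<open>v\<close> holds
  a second edge \<open>g\<close>, then \<open>u\<close> still sees \<open>{u, v}\<close> after the
  removal of \<open>g\<close>, so \<open>u\<close> must own an edge at least as heavy.\<close>

lemma strongly_EFX_orientable_max_weight:
  fixes w :: "'v set \<Rightarrow> nat"
  assumes G: "simple_graph V E" and S: "strongly_EFX_orientable V E"
  obtains h where "orientation E h"
    and "\<And>u v. {u, v} \<in> E \<Longrightarrow> u \<noteq> v \<Longrightarrow> h {u, v} = v \<Longrightarrow> 0 < w {u, v} \<Longrightarrow>
           bndl E h v = {{u, v}} \<or> (\<exists>e\<in>bndl E h u. w {u, v} \<le> w e)"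
proof -
  have "finite V" and EV: "E \<subseteq> Pow V"
    using G by (auto simp: simple_graph_def)
  then have finE: "finite E"
    by (meson finite_Pow_iff finite_subset)
  define f where "f = (\<lambda>u X. real (Max (insert 0 (w ` (X \<inter> incident E u)))))"
  have fin: "finite (X \<inter> incident E u)" for X u
    using finE by (simp add: incident_def)
  have "f u A \<le> f u B" if "A \<subseteq> B" for u A B
    unfolding f_def of_nat_le_iff using that fin by (intro Max_mono) auto
  then have "graphical_instance V E f"
    unfolding graphical_instance_def by (auto simp: f_def Int_assoc)
  then obtain h where h: "EFX_orientation V E f h"
    using S by (auto simp: strongly_EFX_orientable_def)
  show thesis
  proof
    show "orientation E h"
      using h by (simp add: EFX_orientation_def)
  next
    fix u v
    assume uv: "{u, v} \<in> E" "u \<noteq> v" "h {u, v} = v" and pos: "0 < w {u, v}"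
    show "bndl E h v = {{u, v}} \<or> (\<exists>e\<in>bndl E h u. w {u, v} \<le> w e)"
    proof (unfold disj_imp, rule impI)
      assume "bndl E h v \<noteq> {{u, v}}"
      moreover have "{u, v} \<in> bndl E h v"
        using uv by (simp add: bndl_def)
      ultimately obtain g where g: "g \<in> bndl E h v" "g \<noteq> {u, v}"
        by blast
      have "u \<in> V" "v \<in> V"
        using uv EV by auto
      then have "f u (bndl E h v - {g}) \<le> f u (bndl E h u)"
        using h g by (auto simp: EFX_orientation_def)
      moreover have "w {u, v} \<le> Max (insert 0 (w ` ((bndl E h v - {g}) \<inter> incident E u)))"
        using uv g fin by (intro Max_ge) (auto simp: bndl_def incident_def)
      ultimately have le: "w {u, v} \<le> Max (insert 0 (w ` (bndl E h u \<inter> incident E u)))"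
        by (simp add: f_def)
      \<comment> \<open>The maximum may be the default 0 of a bundle without incident edges;
        \<open>pos\<close> excludes this, so an actual edge attains it.\<close>
      moreover have "Max (insert 0 (w ` (bndl E h u \<inter> incident E u)))
          \<in> insert 0 (w ` (bndl E h u \<inter> incident E u))"
        using fin by (intro Max_in) auto
      ultimately show "\<exists>e\<in>bndl E h u. w {u, v} \<le> w e"
        using pos by auto
    qed
  qed
qed

section \<open>The closed walk as an obstruction\<close>

text \<open>The walk is at \<open>x\<close> for index 0 and at \<open>y\<close> for index
  \<open>m\<close>. The two chains may share vertices \<open>A i\<close>, so only the
  \<open>B i\<close> are distinct; this suffices because each \<open>B i\<close> then lies on
  exactly one edge of weight 2.\<close>

lemma strongly_EFX_orientable_no_double_chain:
  fixes A B :: "nat \<Rightarrow> 'v"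
  assumes G: "simple_graph V E" and S: "strongly_EFX_orientable V E"
    and closed: "A N = A 0" and m: "0 < m" "m < N"
    and edges: "\<And>i. i < N \<Longrightarrow> {A i, B i} \<in> E" "\<And>i. i < N \<Longrightarrow> {B i, A (Suc i)} \<in> E"
    and inj: "inj_on B {..<N}"
    and AB: "\<And>i j. i \<le> N \<Longrightarrow> j < N \<Longrightarrow> A i \<noteq> B j"
    and A_Suc: "\<And>i. i < N \<Longrightarrow> A i \<noteq> A (Suc i)"
    and A_0_m: "A 0 \<noteq> A m"
  shows "{A 0, A m} \<notin> E"
proof
  assume xy: "{A 0, A m} \<in> E"
  define w :: "'v set \<Rightarrow> nat" where
    "w e = (if \<exists>i<N. e = {A i, B i} then 2 else if e = {A 0, A m} then 1 else 0)" for e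
  obtain h where h: "orientation E h"
    and efx: "\<And>u v. {u, v} \<in> E \<Longrightarrow> u \<noteq> v \<Longrightarrow> h {u, v} = v \<Longrightarrow> 0 < w {u, v} \<Longrightarrow>
           bndl E h v = {{u, v}} \<or> (\<exists>e\<in>bndl E h u. w {u, v} \<le> w e)"
    using strongly_EFX_orientable_max_weight[OF G S, of w] by metis
  have head: "h {u, v} = u \<or> h {u, v} = v" if "{u, v} \<in> E" for u v
    using h that by (auto simp: orientation_def)
  have w_AB: "w {A i, B i} = 2" if "i < N" for i
    using that by (auto simp: w_def)
  have w_ge_2: "\<exists>i<N. e = {A i, B i}" if "2 \<le> w e" for e
    using that by (auto simp: w_def split: if_splits)
  have B_eq: "i = j" if "B i = B j" "i < N" "j < N" for i j
    using inj that by (auto simp: inj_on_def)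
  have BA_neq_AB: "{B i, A (Suc i)} \<noteq> {A j, B j}" if "i < N" "j < N" for i j
    using that AB[of j i] AB[of "Suc i" j] A_Suc[of i] B_eq[of i j]
    by (auto simp: doubleton_eq_iff)
  have xy_neq_AB: "{A 0, A m} \<noteq> {A j, B j}" if "j < N" for j
    using that AB[of 0 j] AB[of m j] m by (auto simp: doubleton_eq_iff)
  have xy_neq_BA: "{A 0, A m} \<noteq> {B j, A (Suc j)}" if "j < N" for j
    using that AB[of 0 j] AB[of m j] m by (auto simp: doubleton_eq_iff)
  have w_xy: "w {A 0, A m} = 1"
    using xy_neq_AB by (auto simp: w_def)
  \<comment> \<open>Once \<open>A i\<close> takes the only edge of weight 2 at \<open>B i\<close>,
    nothing in the bundle of \<open>B i\<close> can compensate, so \<open>A i\<close> holds nothing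
    else.\<close>
  have good_in: "bndl E h (A i) = {{A i, B i}}" if i: "i < N" and hi: "h {A i, B i} = A i" for i
  proof -
    have "bndl E h (A i) = {{B i, A i}} \<or> (\<exists>e\<in>bndl E h (B i). w {B i, A i} \<le> w e)"
      using efx[of "B i" "A i"] edges(1)[OF i] AB[of i i] i hi w_AB[OF i]
      by (simp add: insert_commute)
    moreover have False if e: "e \<in> bndl E h (B i)" "w {B i, A i} \<le> w e" for e
    proof -
      obtain j where j: "j < N" "e = {A j, B j}"
        using w_ge_2[of e] e w_AB[OF i] by (auto simp: insert_commute)
      then have "B i = A j \<or> B i = B j"
        using e head[of "A j" "B j"] by (auto simp: bndl_def)
      then have "i = j"
        using AB[of j i] B_eq i j by auto
      then show False
        using e j hi AB[of i i] i by (auto simp: bndl_def)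
    qed
    ultimately show ?thesis
      by (auto simp: insert_commute)
  qed
  have good_edge: "\<exists>i<N. A i = A k \<and> e = {A i, B i} \<and> h e = A i"
    if e: "e \<in> bndl E h (A k)" "2 \<le> w e" and k: "k \<le> N" for e k
  proof -
    obtain i where i: "i < N" "e = {A i, B i}"
      using w_ge_2 e by blast
    then show ?thesis
      using e k head[of "A i" "B i"] AB[of k i] by (auto simp: bndl_def)
  qed
  have no_good_in: "e \<notin> bndl E h (A k) \<or> w e < 2"
    if "g \<in> bndl E h (A k)" "\<And>i. i < N \<Longrightarrow> g \<noteq> {A i, B i}" "k \<le> N" for e g k
    using good_edge[of e k] good_in that by (metis not_le singletonD)
  \<comment> \<open>The edge from \<open>B i\<close> keeps every edge of weight 2 out of the bundle
    of \<open>A j\<close>. So \<open>{A j, B j}\<close> goes to \<open>B j\<close>, must be alone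
    there, and pushes the next edge on to \<open>A (Suc j)\<close>. Requiring
    \<open>A (Suc i) = A j\<close> rather than \<open>j = Suc i\<close> also covers the wrap-around
    from \<open>N - 1\<close> to 0.\<close>
  have bad_step: "h {B j, A (Suc j)} = A (Suc j)"
    if i: "i < N" "h {B i, A (Suc i)} = A (Suc i)" and j: "j < N" "A (Suc i) = A j" for i j
  proof -
    have bad: "{B i, A (Suc i)} \<in> bndl E h (A j)"
      using i j edges(2)[of i] by (auto simp: bndl_def)
    have "h {A j, B j} \<noteq> A j"
      using good_in[of j] bad BA_neq_AB[of i j] i j by auto
    then have hj: "h {A j, B j} = B j"
      using head edges(1) j by blast
    then have "bndl E h (B j) = {{A j, B j}} \<or> (\<exists>e\<in>bndl E h (A j). 2 \<le> w e)"
      using efx[of "A j" "B j"] edges(1) AB[of j j] j w_AB by auto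
    then have "bndl E h (B j) = {{A j, B j}}"
      using no_good_in[OF bad] BA_neq_AB i j by (metis less_imp_le not_le)
    then have "{B j, A (Suc j)} \<notin> bndl E h (B j)"
      using BA_neq_AB[of j j] j by auto
    then show ?thesis
      using head[of "B j" "A (Suc j)"] edges(2) j by (auto simp: bndl_def)
  qed
  have up: "h {B j, A (Suc j)} = A (Suc j)"
    if "i \<le> j" "j < N" "h {B i, A (Suc i)} = A (Suc i)" for i j
    using that(1,2)
  proof (induction rule: dec_induct)
    case base
    then show ?case using that by simp
  next
    case (step n)
    then show ?case using bad_step[of n "Suc n"] by simp
  qed
  have all_or_none: "(\<forall>j<N. h {B j, A (Suc j)} = A (Suc j)) \<or> (\<forall>j<N. h {B j, A (Suc j)} = B j)"
  proof (rule disjCI)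
    assume "\<not> (\<forall>j<N. h {B j, A (Suc j)} = B j)"
    then obtain i where i: "i < N" "h {B i, A (Suc i)} = A (Suc i)"
      using head edges(2) by blast
    have "h {B (N - 1), A (Suc (N - 1))} = A (Suc (N - 1))"
      using up[of i "N - 1"] i by simp
    then have "h {B 0, A (Suc 0)} = A (Suc 0)"
      using bad_step[of "N - 1" 0] closed m by simp
    then show "\<forall>j<N. h {B j, A (Suc j)} = A (Suc j)"
      using up[of 0] by blast
  qed
  \<comment> \<open>Both directions of the edge \<open>xy\<close> at once: \<open>A l\<close> is the
    supposed head, \<open>A k\<close> the other end.\<close>
  have "h {A 0, A m} \<noteq> A l" if kl: "k = 0 \<and> l = m \<or> k = m \<and> l = 0" for k l
  proof
    assume hl: "h {A 0, A m} = A l"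
    have kl_eq: "{A k, A l} = {A 0, A m}"
      using kl by auto
    have kl_less: "k < N" "l < N" and kl_neq: "A k \<noteq> A l"
      using kl m A_0_m by auto
    have xy_in: "{A 0, A m} \<in> bndl E h (A l)"
      using hl xy by (simp add: bndl_def)
    consider "\<forall>j<N. h {B j, A (Suc j)} = A (Suc j)" | "\<forall>j<N. h {B j, A (Suc j)} = B j"
      using all_or_none by blast
    then show False
    proof cases
      case 1
      \<comment> \<open>Both ends of \<open>xy\<close> hold an edge of weight 0 from the preceding
        \<open>B i\<close>. Hence \<open>A l\<close> holds two edges, while \<open>A k\<close> has
        no edge of weight 2 and has lost \<open>xy\<close>, the only one of weight 1.\<close>
      have bad_in: "\<exists>i<N. {B i, A (Suc i)} \<in> bndl E h (A j)" if "j = 0 \<or> j = m" for j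
      proof -
        define i where "i = (if j = 0 then N - 1 else j - 1)"
        have "i < N" "A (Suc i) = A j"
          using that m closed by (auto simp: i_def)
        then show ?thesis
          using 1 edges(2)[of i] by (intro exI[of _ i]) (auto simp: bndl_def)
      qed
      obtain i where i: "i < N" "{B i, A (Suc i)} \<in> bndl E h (A k)"
        using bad_in kl by blast
      have "bndl E h (A l) \<noteq> {{A 0, A m}}"
        using bad_in[of l] kl xy_neq_BA by (metis singletonD)
      then obtain e where e: "e \<in> bndl E h (A k)" "1 \<le> w e"
        using efx[of "A k" "A l"] kl_eq kl_neq xy hl w_xy by auto
      have "w e < 2"
        using no_good_in[OF i(2)] e BA_neq_AB i kl_less by (metis less_imp_le)
      then have "e = {A 0, A m}"
        using e by (auto simp: w_def split: if_splits)
      then show False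
        using e hl kl_neq by (simp add: bndl_def)
    next
      case 2
      \<comment> \<open>Holding \<open>xy\<close>, the vertex \<open>A l\<close> can have no edge of
        weight 2, yet \<open>B l\<close> holds two edges, one of them
        \<open>{A l, B l}\<close>.\<close>
      have "h {A l, B l} \<noteq> A l"
        using good_in[of l] xy_in xy_neq_AB[of l] kl_less by auto
      then have "h {A l, B l} = B l"
        using head edges(1) kl_less by blast
      moreover have "bndl E h (B l) \<noteq> {{A l, B l}}"
      proof -
        have "{B l, A (Suc l)} \<in> bndl E h (B l)"
          using 2 edges(2) kl_less by (simp add: bndl_def)
        then show ?thesis
          using BA_neq_AB[of l l] kl_less by auto
      qed
      ultimately obtain e where "e \<in> bndl E h (A l)" "2 \<le> w e"
        using efx[of "A l" "B l"] edges(1) AB[of l l] kl_less w_AB by auto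
      then show False
        using no_good_in[OF xy_in] xy_neq_AB kl_less by (metis less_imp_le not_le)
    qed
  qed
  then show False
    using head[OF xy] by blast
qed

section \<open>Chains without shortcuts\<close>

text \<open>In a chain of minimal length, a repeated element or a forward chord would give a shorter
  chain.\<close>

lemma shortest_chain:
  assumes "(x, y) \<in> R\<^sup>*"
  obtains a :: "nat \<Rightarrow> 'a" and n where "a 0 = x" "a n = y"
    and "\<And>i. i < n \<Longrightarrow> (a i, a (Suc i)) \<in> R"
    and "\<And>i j. i < j \<Longrightarrow> j \<le> n \<Longrightarrow> a i \<noteq> a j"
    and "\<And>i j. Suc i < j \<Longrightarrow> j \<le> n \<Longrightarrow> (a i, a j) \<notin> R"
proof -
  define n where "n = (LEAST n. (x, y) \<in> R ^^ n)"
  have "(x, y) \<in> R ^^ n"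
    using assms unfolding n_def by (metis rtrancl_power LeastI)
  then obtain a where a: "a 0 = x" "a n = y" "\<And>i. i < n \<Longrightarrow> (a i, a (Suc i)) \<in> R"
    by (auto simp: relpow_fun_conv)
  have minimal: "n \<le> k" if "(x, y) \<in> R ^^ k" for k
    using that unfolding n_def by (rule Least_le)
  have sub: "(a i, a j) \<in> R ^^ (j - i)" if "i \<le> j" "j \<le> n" for i j
    unfolding relpow_fun_conv using that a(3)
    by (intro exI[of _ "\<lambda>k. a (i + k)"]) auto
  show thesis
  proof (rule that[OF a])
    fix i j
    assume ij: "i < j" "j \<le> n"
    show "a i \<noteq> a j"
    proof
      assume "a i = a j"
      then have "(x, y) \<in> R ^^ (i + (n - j))"
        unfolding relpow_add using sub[of 0 i] sub[of j n] ij a by auto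
      then show False
        using minimal ij by fastforce
    qed
  next
    fix i j
    assume ij: "Suc i < j" "j \<le> n"
    show "(a i, a j) \<notin> R"
    proof
      assume "(a i, a j) \<in> R"
      then have "(x, a j) \<in> R ^^ Suc i"
        using sub[of 0 i] ij a by auto
      then have "(x, y) \<in> R ^^ (Suc i + (n - j))"
        unfolding relpow_add using sub[of j n] ij a by auto
      then show False
        using minimal ij by fastforce
    qed
  qed
qed

section \<open>Kempe chains\<close>

text \<open>Two consecutive edges of a Kempe chain count as one step between vertices of colour
  \<open>p\<close>, which matches the alternation of \<open>A i\<close> and \<open>B i\<close> in
  the walk.\<close>

definition kempe_step :: "'v set set \<Rightarrow> ('v \<Rightarrow> nat) \<Rightarrow> nat \<Rightarrow> nat \<Rightarrow> ('v \<times> 'v) set" where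
  "kempe_step E c p q = {(u, v). c u = p \<and> c v = p \<and> (\<exists>b. c b = q \<and> {u, b} \<in> E \<and> {b, v} \<in> E)}"

lemma sym_kempe_step: "sym (kempe_step E c p q)"
  by (auto simp: sym_def kempe_step_def insert_commute)

definition proper_3_coloring :: "'v set \<Rightarrow> 'v set set \<Rightarrow> ('v \<Rightarrow> nat) \<Rightarrow> bool" where
  "proper_3_coloring V E c \<longleftrightarrow> (\<forall>v\<in>V. c v < 3) \<and> (\<forall>u v. {u, v} \<in> E \<longrightarrow> u \<noteq> v \<longrightarrow> c u \<noteq> c v)"

text \<open>Otherwise, swapping the colours \<open>c x\<close> and \<open>q\<close> on the Kempe
  component of \<open>x\<close> changes the colour of \<open>x\<close> but not that of
  \<open>y\<close>, and the edge \<open>{x, y}\<close> could be added.\<close>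

lemma kempe_chain:
  assumes c: "proper_3_coloring V E c"
    and max: "\<nexists>c. proper_3_coloring V (insert {x, y} E) c"
    and xV: "x \<in> V" and same: "c x = c y" and q: "q < 3" "q \<noteq> c x"
  shows "(x, y) \<in> (kempe_step E c (c x) q)\<^sup>*"
proof (rule ccontr)
  let ?R = "(kempe_step E c (c x) q)\<^sup>*"
  assume nxy: "(x, y) \<notin> ?R"
  \<comment> \<open>The Kempe component of \<open>x\<close>. Steps reach only vertices of colour
    \<open>c x\<close>, so their neighbours of colour \<open>q\<close> are added.\<close>
  define D where "D = {v. (x, v) \<in> ?R} \<union> {b. c b = q \<and> (\<exists>u. (x, u) \<in> ?R \<and> {u, b} \<in> E)}"
  have reach: "c v = c x" if "(x, v) \<in> ?R" for v
    using that by (induction rule: rtrancl_induct) (auto simp: kempe_step_def)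
  define c' where "c' v = (if v \<in> D then if c v = q then c x else q else c v)" for v
  have cross: "v \<in> D \<or> (c v \<noteq> c x \<and> c v \<noteq> q)" if e: "{u, v} \<in> E" "u \<noteq> v" and u: "u \<in> D" for u v
  proof -
    have "c u \<noteq> c v"
      using c e by (simp add: proper_3_coloring_def)
    consider "(x, u) \<in> ?R" | t where "c u = q" "(x, t) \<in> ?R" "{t, u} \<in> E"
      using u by (auto simp: D_def)
    then show ?thesis
    proof cases
      case 1
      then show ?thesis
        using e reach[OF 1] \<open>c u \<noteq> c v\<close> by (auto simp: D_def)
    next
      case 2
      have "(x, v) \<in> ?R" if "c v = c x"
      proof -
        have "(t, v) \<in> kempe_step E c (c x) q"
          using 2(1,3) e(1) that reach[OF 2(2)] by (auto simp: kempe_step_def)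
        then show ?thesis
          using 2(2) by (rule rtrancl_into_rtrancl[rotated])
      qed
      then show ?thesis
        using 2 \<open>c u \<noteq> c v\<close> by (auto simp: D_def)
    qed
  qed
  have D_colors: "c v = c x \<or> c v = q" if "v \<in> D" for v
    using that reach unfolding D_def by blast
  have "c' u \<noteq> c' v" if e: "{u, v} \<in> E" "u \<noteq> v" for u v
  proof -
    have "c u \<noteq> c v"
      using c e by (simp add: proper_3_coloring_def)
    then show ?thesis
      using cross[of u v] cross[of v u] e D_colors[of u] D_colors[of v] q
      by (auto simp: c'_def insert_commute)
  qed
  moreover have "c' x \<noteq> c' y"
  proof -
    have "x \<in> D" "y \<notin> D"
      using nxy same q by (auto simp: D_def)
    then show ?thesis
      using q same by (simp add: c'_def)
  qed
  moreover have "c' v < 3" if "v \<in> V" for v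
    using that c xV q by (auto simp: c'_def proper_3_coloring_def)
  ultimately have "proper_3_coloring V (insert {x, y} E) c'"
    by (auto simp: proper_3_coloring_def doubleton_eq_iff)
  then show False
    using max by blast
qed

lemma kempe_path:
  assumes "(x, y) \<in> (kempe_step E c p q)\<^sup>*" and "c x = p"
  obtains a b :: "nat \<Rightarrow> 'v" and n where "a 0 = x" "a n = y"
    and "\<And>i. i < n \<Longrightarrow> {a i, b i} \<in> E \<and> {b i, a (Suc i)} \<in> E \<and> a i \<noteq> a (Suc i) \<and> c (b i) = q"
    and "inj_on b {..<n}"
    and "\<And>i. i \<le> n \<Longrightarrow> c (a i) = p"
proof -
  obtain a n where a: "a 0 = x" "a n = y"
    and R: "\<And>i. i < n \<Longrightarrow> (a i, a (Suc i)) \<in> kempe_step E c p q"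
    and dist: "\<And>i j. i < j \<Longrightarrow> j \<le> n \<Longrightarrow> a i \<noteq> a j"
    and short: "\<And>i j. Suc i < j \<Longrightarrow> j \<le> n \<Longrightarrow> (a i, a j) \<notin> kempe_step E c p q"
    using shortest_chain[OF assms(1)] by metis
  have "\<exists>b. \<forall>i<n. c (b i) = q \<and> {a i, b i} \<in> E \<and> {b i, a (Suc i)} \<in> E"
    using R unfolding kempe_step_def by (intro choice) blast
  then obtain b where b: "\<And>i. i < n \<Longrightarrow> c (b i) = q \<and> {a i, b i} \<in> E \<and> {b i, a (Suc i)} \<in> E"
    by blast
  \<comment> \<open>A common middle vertex would give a single step from \<open>a i\<close> to
    \<open>a (Suc j)\<close>, a chord of the shortest chain.\<close>
  have "b i \<noteq> b j" if ij: "i < j" "j < n" for i j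
  proof
    assume "b i = b j"
    then have "(a i, a (Suc j)) \<in> kempe_step E c p q"
      using b[of i] b[of j] R[of i] R[of j] ij by (auto simp: kempe_step_def)
    then show False
      using short[of i "Suc j"] ij by simp
  qed
  then have "inj_on b {..<n}"
    by (auto intro: linorder_inj_onI)
  moreover have "c (a i) = p" if "i \<le> n" for i
    using assms(2) that R[of "i - 1"] a by (cases i) (auto simp: kempe_step_def)
  ultimately show thesis
    using that[of a n b] a b dist by (metis Suc_leI lessI)
qed

section \<open>Three-colourability and the chromatic number\<close>

lemma strongly_EFX_orientable_3_colorable:
  assumes G: "simple_graph V E" and S: "strongly_EFX_orientable V E"
  shows "\<exists>c. proper_3_coloring V E c"
proof (rule ccontr)
  assume not_col: "\<nexists>c. proper_3_coloring V E c"
  have "finite V" and EV: "E \<subseteq> Pow V" and card2: "\<And>e. e \<in> E \<Longrightarrow> card e = 2"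
    using G by (auto simp: simple_graph_def)
  then have "finite E"
    by (meson finite_Pow_iff finite_subset)
  let ?C = "{F. F \<subseteq> E \<and> (\<exists>c. proper_3_coloring V F c)}"
  have "finite ?C"
    using \<open>finite E\<close> by simp
  moreover have "?C \<noteq> {}"
    by (auto simp: proper_3_coloring_def intro!: exI[of _ "{}"] exI[of _ "\<lambda>_. 0"])
  ultimately have "\<exists>F\<in>?C. \<forall>F'\<in>?C. F \<subseteq> F' \<longrightarrow> F = F'"
    by (rule finite_has_maximal)
  then obtain F where F: "F \<in> ?C" and Fmax: "\<And>F'. F' \<in> ?C \<Longrightarrow> F \<subseteq> F' \<Longrightarrow> F = F'"
    by (elim bexE) simp
  then obtain c where c: "proper_3_coloring V F c"
    by blast
  have "F \<noteq> E"
    using F not_col by blast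
  then obtain e where e: "e \<in> E" "e \<notin> F"
    using F by blast
  obtain x y where xy: "e = {x, y}" "x \<noteq> y"
    using card2[OF e(1)] by (meson card_2_iff)
  have xV: "x \<in> V"
    using e xy EV by auto
  have max: "\<nexists>c. proper_3_coloring V (insert {x, y} F) c"
    using Fmax[of "insert {x, y} F"] F e xy by blast
  have same: "c x = c y"
  proof (rule ccontr)
    assume "c x \<noteq> c y"
    then have "proper_3_coloring V (insert {x, y} F) c"
      using c by (auto simp: proper_3_coloring_def doubleton_eq_iff)
    then show False
      using max by blast
  qed
  obtain p q where pq: "p < 3" "q < 3" "p \<noteq> c x" "q \<noteq> c x" "p \<noteq> q"
  proof -
    have "c x < 3"
      using c xV by (simp add: proper_3_coloring_def)
    then show thesis
      by (intro that[of "(c x + 1) mod 3" "(c x + 2) mod 3"]) presburger+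
  qed
  have "(x, y) \<in> (kempe_step F c (c x) p)\<^sup>*"
    using kempe_chain[OF c max xV same] pq by blast
  then obtain a b n where ab: "a 0 = x" "a n = y"
    "\<And>i. i < n \<Longrightarrow> {a i, b i} \<in> F \<and> {b i, a (Suc i)} \<in> F \<and> a i \<noteq> a (Suc i) \<and> c (b i) = p"
    "inj_on b {..<n}" "\<And>i. i \<le> n \<Longrightarrow> c (a i) = c x"
    by (rule kempe_path) (rule refl, blast)
  have "(y, x) \<in> (kempe_step F c (c x) q)\<^sup>*"
    using kempe_chain[OF c max xV same] pq sym_kempe_step by (metis sym_rtrancl symD)
  then obtain a' b' n' where ab': "a' 0 = y" "a' n' = x"
    "\<And>i. i < n' \<Longrightarrow> {a' i, b' i} \<in> F \<and> {b' i, a' (Suc i)} \<in> F \<and> a' i \<noteq> a' (Suc i) \<and> c (b' i) = q"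
    "inj_on b' {..<n'}" "\<And>i. i \<le> n' \<Longrightarrow> c (a' i) = c x"
    by (rule kempe_path) (rule same[symmetric], blast)
  have pos: "0 < n" "0 < n'"
    using ab(1,2) ab'(1,2) xy(2) by (metis gr0I)+
  \<comment> \<open>The chain through colour \<open>p\<close> from \<open>x\<close> to
    \<open>y\<close>, followed by the one through \<open>q\<close> back to \<open>x\<close>. At the
    seam, \<open>a n\<close> and \<open>a' 0\<close> are both \<open>y\<close>.\<close>
  define A where "A i = (if i < n then a i else a' (i - n))" for i
  define B where "B i = (if i < n then b i else b' (i - n))" for i
  have A_le: "A i = a i" if "i \<le> n" for i
    using that ab(2) ab'(1) by (auto simp: A_def)
  have A_ge: "A i = a' (i - n)" if "n \<le> i" for i
    using that by (simp add: A_def)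
  have walk: "{A i, B i} \<in> F \<and> {B i, A (Suc i)} \<in> F \<and> A i \<noteq> A (Suc i) \<and> c (B i) \<noteq> c x"
    if "i < n + n'" for i
  proof (cases "i < n")
    case True
    then show ?thesis
      using ab(3)[of i] A_le[of i] A_le[of "Suc i"] pq by (simp add: B_def)
  next
    case False
    then show ?thesis
      using ab'(3)[of "i - n"] A_ge[of i] A_ge[of "Suc i"] that pq by (simp add: B_def Suc_diff_le)
  qed
  have cA: "c (A i) = c x" if "i \<le> n + n'" for i
    using that ab(5) ab'(5) by (simp add: A_def)
  have inj: "inj_on B {..<n + n'}"
  proof (rule inj_onI)
    fix i j
    assume ij: "i \<in> {..<n + n'}" "j \<in> {..<n + n'}" "B i = B j"
    \<comment> \<open>The colours separate the middle vertices of the two chains; within one chain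
      they are distinct already.\<close>
    have col: "c (B k) = (if k < n then p else q)" if "k < n + n'" for k
      using that ab(3) ab'(3) by (auto simp: B_def)
    have "i < n \<longleftrightarrow> j < n"
      using ij col[of i] col[of j] pq(5) by (auto split: if_splits)
    then consider "i < n" "j < n" | "n \<le> i" "n \<le> j"
      by linarith
    then show "i = j"
    proof cases
      case 1
      then show ?thesis
        using ij inj_onD[OF ab(4), of i j] by (simp add: B_def)
    next
      case 2
      then have "i - n = j - n"
        using ij by (intro inj_onD[OF ab'(4)]) (auto simp: B_def)
      then show ?thesis
        using 2 by linarith
    qed
  qed
  have "{A 0, A n} \<notin> E"
  proof (rule strongly_EFX_orientable_no_double_chain[OF G S, where N = "n + n'" and B = B])
    show "A (n + n') = A 0"
      using A_le[of 0] A_ge[of "n + n'"] ab(1) ab'(2) by simp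
    show "0 < n" "n < n + n'"
      using pos by auto
    show "A 0 \<noteq> A n"
      using A_le ab(1,2) xy by simp
    show "A i \<noteq> B j" if "i \<le> n + n'" "j < n + n'" for i j
      using cA walk that by metis
  qed (use walk F inj in auto)
  then show False
    using A_le ab(1,2) e xy by simp
qed

theorem mainTheorem5:
  fixes V :: "'v set" and E :: "'v set set"
  assumes "simple_graph V E"
    and "strongly_EFX_orientable V E"
  shows "chromatic_number V E \<le> 3"
proof -
  obtain c where c: "proper_3_coloring V E c"
    using strongly_EFX_orientable_3_colorable assms by blast
  have "c u \<noteq> c w" if "e \<in> E" "u \<in> e" "w \<in> e" "u \<noteq> w" for e u w
  proof -
    have "card e = 2"
      using assms(1) that by (simp add: simple_graph_def)
    then have "e = {u, w}"
      using that by (auto simp: card_2_iff)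
    then show ?thesis
      using c that by (simp add: proper_3_coloring_def)
  qed
  then have "colorable V E 3"
    using c by (auto simp: colorable_def proper_3_coloring_def)
  then show ?thesis
    unfolding chromatic_number_def by (rule Least_le)
qed

end
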